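(* Let $n\ge2$ be an integer and let $N$ be the homogeneous norm on the anisotropic Heisenberg group $\mathbb{H}_{2n}(\tfrac12,1)=\mathbb{R}^{2n+1}$ given, for $(x,t)\in\mathbb{R}^{2n}\times\mathbb{R}$, $(x,t)\ne(0,0)$, by $$N(x,t)=\frac{\left(B^{2}+t^{2}\right)^{\frac{1}{4n}}\left(AB+t^{2}+A\sqrt{B^{2}+t^{2}}\right)^{\frac{1}{2}-\frac{1}{4n}}}{\left(B+\sqrt{B^{2}+t^{2}}\right)^{\frac{1}{2}}},$$ with $$A=\frac{x_1^2+x_{n+1}^2}{2}+\frac12\sum_{\substack{2\le j\le 2n\\ j\ne n+1}}x_j^2,\qquad B=\frac{x_1^2+x_{n+1}^2}{4}+\frac12\sum_{\substack{2\le j\le 2n\\ j\ne n+1}}x_j^2 .$$ Then at every point of $\mathbb{R}^{2n+1}\setminus\{0\}$, $$x\cdot\nabla N\ \ge\ -\frac{|x|^{2}}{4nN},\qquad |\nabla N|^{2}\ \ge\ \frac{|x|^{2}}{2^{5+\frac{2}{n}}N^{2}},\qquad |\nabla N|^{2}\ \le\ \frac{(2n+1)^{2}|x|^{2}}{2^{3}n^{2}N^{2}} .$$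
   Context: $\nabla=(X_1,\dots,X_{2n})$ is the sub-gradient, where $X_1=\partial_{x_1}-\frac{x_{n+1}}{2}\partial_t$, $X_{n+1}=\partial_{x_{n+1}}+\frac{x_1}{2}\partial_t$, $X_j=\partial_{x_j}-x_{j+n}\partial_t$ for $j=2,\dots,n$, and $X_j=\partial_{x_j}+x_{j-n}\partial_t$ for $j=n+2,\dots,2n$. Here $|x|=\big(\sum_{j=1}^{2n}x_j^2\big)^{1/2}$, $x\cdot\nabla N=\sum_{j=1}^{2n}x_jX_jN$ and $|\nabla N|^2=\sum_{j=1}^{2n}(X_jN)^2$. *)

theory Defs
  imports "HOL-Analysis.Analysis"
begin

text \<open>
  A point \<open>(x, t)\<close> of \<open>\<real>\<^sup>2\<^sup>n \<times> \<real>\<close> is given by \<open>x :: nat \<Rightarrow> real\<close>, of which only the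
  coordinates \<open>x 1, \<dots>, x (2 * n)\<close> are relevant (everything below ignores the others), and
  \<open>t :: real\<close>.  Accordingly, a function on \<open>\<real>\<^sup>2\<^sup>n \<times> \<real>\<close> is a curried function of \<open>x\<close> and \<open>t\<close>.
\<close>

definition partial_x ::
    "nat \<Rightarrow> ((nat \<Rightarrow> real) \<Rightarrow> real \<Rightarrow> real) \<Rightarrow> (nat \<Rightarrow> real) \<Rightarrow> real \<Rightarrow> real" where
  "partial_x j f x t = deriv (\<lambda>s. f (x(j := s)) t) (x j)"

definition partial_t ::
    "((nat \<Rightarrow> real) \<Rightarrow> real \<Rightarrow> real) \<Rightarrow> (nat \<Rightarrow> real) \<Rightarrow> real \<Rightarrow> real" where
  "partial_t f x t = deriv (\<lambda>s. f x s) t"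

text \<open>Meaningful for \<open>1 \<le> j \<le> 2 * n\<close>; the last case is \<open>n + 2 \<le> j \<le> 2 * n\<close>.\<close>

definition vfield ::
    "nat \<Rightarrow> nat \<Rightarrow> ((nat \<Rightarrow> real) \<Rightarrow> real \<Rightarrow> real) \<Rightarrow> (nat \<Rightarrow> real) \<Rightarrow> real \<Rightarrow> real" where
  "vfield n j f x t =
     (if j = 1 then partial_x 1 f x t - x (n + 1) / 2 * partial_t f x t
      else if j = n + 1 then partial_x (n + 1) f x t + x 1 / 2 * partial_t f x t
      else if j \<le> n then partial_x j f x t - x (j + n) * partial_t f x t
      else partial_x j f x t + x (j - n) * partial_t f x t)"

definition xnorm :: "nat \<Rightarrow> (nat \<Rightarrow> real) \<Rightarrow> real" where
  "xnorm n x = sqrt (\<Sum>j=1..2*n. (x j)\<^sup>2)"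

definition x_dot_subgrad ::
    "nat \<Rightarrow> ((nat \<Rightarrow> real) \<Rightarrow> real \<Rightarrow> real) \<Rightarrow> (nat \<Rightarrow> real) \<Rightarrow> real \<Rightarrow> real" where
  "x_dot_subgrad n f x t = (\<Sum>j=1..2*n. x j * vfield n j f x t)"

definition subgrad_norm_sq ::
    "nat \<Rightarrow> ((nat \<Rightarrow> real) \<Rightarrow> real \<Rightarrow> real) \<Rightarrow> (nat \<Rightarrow> real) \<Rightarrow> real \<Rightarrow> real" where
  "subgrad_norm_sq n f x t = (\<Sum>j=1..2*n. (vfield n j f x t)\<^sup>2)"

definition A_fun :: "nat \<Rightarrow> (nat \<Rightarrow> real) \<Rightarrow> real" where
  "A_fun n x = ((x 1)\<^sup>2 + (x (n + 1))\<^sup>2) / 2 + (1 / 2) * (\<Sum>j\<in>{2..2*n} - {n + 1}. (x j)\<^sup>2)"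

definition B_fun :: "nat \<Rightarrow> (nat \<Rightarrow> real) \<Rightarrow> real" where
  "B_fun n x = ((x 1)\<^sup>2 + (x (n + 1))\<^sup>2) / 4 + (1 / 2) * (\<Sum>j\<in>{2..2*n} - {n + 1}. (x j)\<^sup>2)"

text \<open>Used only at points other than the origin, where all bases of powers are positive.\<close>

definition N_fun :: "nat \<Rightarrow> (nat \<Rightarrow> real) \<Rightarrow> real \<Rightarrow> real" where
  "N_fun n x t =
     (let A = A_fun n x; B = B_fun n x in
        ((B\<^sup>2 + t\<^sup>2) powr (1 / (4 * real n))
          * (A * B + t\<^sup>2 + A * sqrt (B\<^sup>2 + t\<^sup>2)) powr (1 / 2 - 1 / (4 * real n)))
        / (B + sqrt (B\<^sup>2 + t\<^sup>2)) powr (1 / 2))"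

end

theory Submission
  imports Defs
begin

text \<open>
  Write \<open>u = x\<^sub>1\<^sup>2 + x\<^sub>n\<^sub>+\<^sub>1\<^sup>2\<close>, let \<open>v\<close> be the sum of the remaining squares, and put
  \<open>B = u / 4 + v / 2\<close>, \<open>R = sqrt (B\<^sup>2 + t\<^sup>2)\<close>, \<open>a = 1 / (4 n)\<close>.  Since \<open>A = B + u / 4\<close> and
  \<open>t\<^sup>2 = (R - B) (R + B)\<close>, the middle factor of \<open>N\<close> splits as \<open>(R + B) (R + u / 4)\<close>, so that \<open>N\<close> is the
  monomial \<open>R\<^sup>2\<^sup>a (R + B)\<^sup>-\<^sup>a (R + u / 4)\<^sup>1\<^sup>/\<^sup>2\<^sup>-\<^sup>a\<close>.  The cross terms of the vector fields cancel in pairs,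
  which turns both gradient expressions into combinations of \<open>u\<close> and \<open>v\<close>, and it suffices to compare the
  coefficients of \<open>u\<close> and of \<open>v\<close>.  After scaling by \<open>R\<close> these depend only on \<open>\<beta> = B / R\<close> and
  \<open>\<sigma> = R / (R + u / 4)\<close>, subject to \<open>\<sigma> \<le> 1 \<le> \<sigma> (1 + \<beta>)\<close> (from \<open>u / 4 \<le> B\<close>), and the powers in \<open>N\<close>
  enter only through \<open>2\<^sup>-\<^sup>2\<^sup>a R \<le> N\<^sup>2 \<le> R + u / 4\<close>.
\<close>

section \<open>The norm in reduced variables and its logarithmic derivatives\<close>

definition R_fun :: "real \<Rightarrow> real \<Rightarrow> real \<Rightarrow> real" where
  "R_fun u v t = sqrt ((u / 4 + v / 2)\<^sup>2 + t\<^sup>2)"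

definition G_fun :: "real \<Rightarrow> real \<Rightarrow> real \<Rightarrow> real \<Rightarrow> real" where
  "G_fun a u v t = R_fun u v t powr (2 * a) * (R_fun u v t + (u / 4 + v / 2)) powr (- a)
     * (R_fun u v t + u / 4) powr (1 / 2 - a)"

text \<open>
  With \<open>\<tau> = t / R\<close>, the logarithmic derivatives of \<open>N\<close> in \<open>u\<close>, \<open>v\<close>, \<open>t\<close> are
  \<open>(ell + (1 / 2 - a) \<sigma>) / (4 R)\<close>, \<open>ell / (2 R)\<close> and \<open>\<tau> emm / R\<close>.
\<close>

definition ell :: "real \<Rightarrow> real \<Rightarrow> real \<Rightarrow> real" where
  "ell a \<beta> \<sigma> = 2 * a * \<beta> - a + (1 / 2 - a) * \<beta> * \<sigma>"

definition emm :: "real \<Rightarrow> real \<Rightarrow> real \<Rightarrow> real" where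
  "emm a \<beta> \<sigma> = 2 * a - a / (1 + \<beta>) + (1 / 2 - a) * \<sigma>"

text \<open>Logarithmic differentiation: keeping the product itself as a factor leaves a sum of
  logarithmic derivatives weighted by the exponents.\<close>

lemma DERIV_powr_product:
  fixes f g h :: "real \<Rightarrow> real"
  assumes "(f has_real_derivative f') (at s)" "(g has_real_derivative g') (at s)"
    "(h has_real_derivative h') (at s)" and "f s > 0" "g s > 0" "h s > 0"
  shows "((\<lambda>s. f s powr p * g s powr q * h s powr r) has_real_derivative
    (f s powr p * g s powr q * h s powr r) * (p * f' / f s + q * g' / g s + r * h' / h s)) (at s)"
proof -
  have D: "((\<lambda>s. k s powr c) has_real_derivative k s powr c * (c * k' / k s)) (at s)"
    if "(k has_real_derivative k') (at s)" "k s > 0" for k k' c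
    using DERIV_fun_powr[OF that, of c] that(2) by (simp add: powr_diff mult_ac)
  have "((\<lambda>s. f s powr p * g s powr q * h s powr r) has_real_derivative
    f s powr p * (p * f' / f s) * g s powr q * h s powr r
    + g s powr q * (q * g' / g s) * (f s powr p) * h s powr r
    + h s powr r * (r * h' / h s) * (f s powr p * g s powr q)) (at s)"
    using DERIV_mult[OF DERIV_mult[OF D[OF assms(1,4)] D[OF assms(2,5)]] D[OF assms(3,6)]]
    by (simp only: distrib_right)
  then show ?thesis by (simp only: distrib_left mult_ac)
qed

section \<open>Lower bounds for the coefficients of u and v\<close>

text \<open>With \<open>y = 1 / (1 + \<beta>)\<close>, both 1 and \<sigma> dominate y. Replacing
  \<open>2 * a\<close> by \<open>2 * a * y\<close> and \<sigma> by y leaves y / 2, since the terms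
  in a cancel.\<close>

lemma emm_ge:
  assumes "0 < a" "a \<le> 1 / 8" "0 \<le> \<beta>" "\<beta> \<le> 1" "1 \<le> \<sigma> * (1 + \<beta>)"
  shows "1 / (2 * (1 + \<beta>)) \<le> emm a \<beta> \<sigma>"
proof -
  define y where "y = 1 / (1 + \<beta>)"
  have y: "y \<le> 1" "y \<le> \<sigma>" using assms by (auto simp: y_def field_simps)
  have "(1 / 2 - a) * y \<le> (1 / 2 - a) * \<sigma>"
    using assms by (intro mult_left_mono[OF y(2)]) auto
  moreover have "2 * a * y \<le> 2 * a * 1"
    using assms y by (intro mult_left_mono) auto
  moreover have "emm a \<beta> \<sigma> = 2 * a - a * y + (1 / 2 - a) * \<sigma>" "1 / (2 * (1 + \<beta>)) = y / 2"
    by (simp_all add: emm_def y_def)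
  ultimately show ?thesis by (simp add: algebra_simps)
qed

text \<open>Square \<open>emm_ge\<close>; the factor 1 + \<beta> of 1 - \<beta>^2 cancels once
  against the squared denominator.\<close>

lemma tau_emm_ge:
  assumes "0 < a" "a \<le> 1 / 8" "0 \<le> \<beta>" "\<beta> \<le> 1" "1 \<le> \<sigma> * (1 + \<beta>)" "\<tau>\<^sup>2 = 1 - \<beta>\<^sup>2"
  shows "(1 - \<beta>) / (4 * (1 + \<beta>)) \<le> (\<tau> * emm a \<beta> \<sigma>)\<^sup>2"
proof -
  have "(1 / (2 * (1 + \<beta>)))\<^sup>2 \<le> (emm a \<beta> \<sigma>)\<^sup>2"
    using emm_ge[OF assms(1-5)] assms by (intro power_mono) auto
  then have "(1 - \<beta>\<^sup>2) * (1 / (2 * (1 + \<beta>)))\<^sup>2 \<le> (\<tau> * emm a \<beta> \<sigma>)\<^sup>2"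
    using assms unfolding power_mult_distrib by (auto intro!: mult_left_mono simp: abs_square_le_1)
  moreover have "(1 - \<beta>\<^sup>2) * (1 / (2 * (1 + \<beta>)))\<^sup>2 = (1 - \<beta>) / (4 * (1 + \<beta>))"
  proof -
    have e: "1 - \<beta>\<^sup>2 = (1 - \<beta>) * (1 + \<beta>)" by (simp add: power2_eq_square algebra_simps)
    show ?thesis unfolding e power2_eq_square using assms by (simp add: divide_simps) (simp add: algebra_simps)
  qed
  ultimately show ?thesis by simp
qed

text \<open>The left side of the bound \<sigma> (1 + \<beta>) \<ge> 1 appears with coefficient 1/2 -
  a, so the sum is at least 1/2 - 2a (1 - \<beta>), and a \<le> 1/8 turns this into (1 + \<beta>) /
  4.\<close>

lemma ell_plus_sigma_ge:
  assumes "0 < a" "a \<le> 1 / 8" "0 \<le> \<beta>" "\<beta> \<le> 1" "1 \<le> \<sigma> * (1 + \<beta>)"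
  shows "(1 + \<beta>) / 4 \<le> ell a \<beta> \<sigma> + (1 / 2 - a) * \<sigma>"
proof -
  have "(1 / 2 - a) * 1 \<le> (1 / 2 - a) * (\<sigma> * (1 + \<beta>))"
    using assms by (intro mult_left_mono) auto
  moreover have "2 * a * (1 - \<beta>) \<le> 2 * (1 / 8) * (1 - \<beta>)"
    using assms by (intro mult_right_mono) auto
  ultimately show ?thesis unfolding ell_def by (simp add: algebra_simps add_divide_distrib)
qed

lemma ell_ge:
  assumes "0 < a" "a \<le> 1 / 8" "0 \<le> \<beta>" "\<beta> \<le> 1" "1 \<le> \<sigma> * (1 + \<beta>)"
  shows "a * (2 * \<beta> - 1) + (1 / 2 - a) * (\<beta> / (1 + \<beta>)) \<le> ell a \<beta> \<sigma>"
proof -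
  have "\<beta> / (1 + \<beta>) \<le> \<beta> * \<sigma>"
    using assms mult_left_mono[OF assms(5,3)] by (simp add: field_simps)
  then have "(1 / 2 - a) * (\<beta> / (1 + \<beta>)) \<le> (1 / 2 - a) * (\<beta> * \<sigma>)"
    using assms by (intro mult_left_mono) auto
  moreover have "ell a \<beta> \<sigma> = a * (2 * \<beta> - 1) + (1 / 2 - a) * (\<beta> * \<sigma>)"
    by (simp add: ell_def algebra_simps)
  ultimately show ?thesis by linarith
qed

text \<open>Drop the nonnegative second term of \<open>ell_ge\<close> and use \<beta> / (1 +
  \<beta>) \<le> 2 \<beta>. The denominator 1 + \<beta> is kept because the bound on
  \<open>x_dot_subgrad\<close> later absorbs it through N^2 \<le> R (1 + \<beta>).\<close>

lemma ell_ge_neg: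
  assumes "0 < a" "a \<le> 1 / 8" "0 \<le> \<beta>" "\<beta> \<le> 1" "1 \<le> \<sigma> * (1 + \<beta>)"
  shows "- (a / (1 + \<beta>)) \<le> ell a \<beta> \<sigma>"
proof -
  have "a * (1 - 1 / (1 + \<beta>)) \<le> a * (2 * \<beta>)"
    using assms by (intro mult_left_mono) (auto simp: field_simps)
  moreover have "0 \<le> (1 / 2 - a) * (\<beta> / (1 + \<beta>))" using assms by simp
  ultimately show ?thesis using ell_ge[OF assms] by (simp add: algebra_simps)
qed

text \<open>Small \<beta> is handled by the \<open>emm\<close> term, large \<beta> by the
  \<open>ell\<close> term. The threshold 7/9 is where (1 - \<beta>) / (4 (1 + \<beta>)) equals
  1/32.\<close>

lemma v_coefficient_lower:
  assumes "0 < a" "a \<le> 1 / 8" "0 \<le> \<beta>" "\<beta> \<le> 1" "1 \<le> \<sigma> * (1 + \<beta>)" "\<tau>\<^sup>2 = 1 - \<beta>\<^sup>2"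
  shows "1 / 32 \<le> (ell a \<beta> \<sigma>)\<^sup>2 + (\<tau> * emm a \<beta> \<sigma>)\<^sup>2"
proof (cases "\<beta> \<le> 7 / 9")
  case True
  then have "1 / 32 \<le> (1 - \<beta>) / (4 * (1 + \<beta>))" using assms by (simp add: field_simps)
  with tau_emm_ge[OF assms] show ?thesis using zero_le_power2[of "ell a \<beta> \<sigma>"] by linarith
next
  case False
  define y where "y = \<beta> / (1 + \<beta>)"
  have y: "y \<le> 1 / 2" "7 / 16 \<le> y" using assms False by (auto simp: y_def field_simps)
  \<comment> \<open>Here 2 \<beta> - 1 > 5/9 > 1/2 \<ge> y, so \<open>ell_ge\<close> gives at least
    a y + (1/2 - a) y = y / 2, free of a.\<close>
  have "0 \<le> a * (2 * \<beta> - 1 - y)"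
    using assms False y by (intro mult_nonneg_nonneg) linarith+
  then have "7 / 32 \<le> ell a \<beta> \<sigma>"
    using ell_ge[OF assms(1-5), folded y_def] y by (simp add: algebra_simps)
  then have "(7 / 32)\<^sup>2 \<le> (ell a \<beta> \<sigma>)\<^sup>2" by (intro power_mono) auto
  moreover have "(1::real) / 32 \<le> (7 / 32)\<^sup>2" by (simp add: power2_eq_square)
  ultimately show ?thesis using zero_le_power2[of "\<tau> * emm a \<beta> \<sigma>"] by linarith
qed

text \<open>The constant is 4 / 32 because the coefficient of u carries an extra factor 1/4. The
  bound (1 - \<beta>) / (4 (1 + \<beta>)) equals 1/8 at \<beta> = 1/3; beyond that, both squares
  contribute.\<close>

lemma u_coefficient_lower:
  assumes "0 < a" "a \<le> 1 / 8" "0 \<le> \<beta>" "\<beta> \<le> 1" "1 \<le> \<sigma> * (1 + \<beta>)" "\<tau>\<^sup>2 = 1 - \<beta>\<^sup>2"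
  shows "1 / 8 \<le> (ell a \<beta> \<sigma> + (1 / 2 - a) * \<sigma>)\<^sup>2 + (\<tau> * emm a \<beta> \<sigma>)\<^sup>2"
proof (cases "\<beta> \<le> 1 / 3")
  case True
  then have "1 / 8 \<le> (1 - \<beta>) / (4 * (1 + \<beta>))" using assms by (simp add: field_simps)
  with tau_emm_ge[OF assms] show ?thesis
    using zero_le_power2[of "ell a \<beta> \<sigma> + (1 / 2 - a) * \<sigma>"] by linarith
next
  case False
  have "((1 + \<beta>) / 4)\<^sup>2 \<le> (ell a \<beta> \<sigma> + (1 / 2 - a) * \<sigma>)\<^sup>2"
    using ell_plus_sigma_ge[OF assms(1-5)] assms by (intro power_mono) auto
  moreover have "(1 + \<beta>)\<^sup>2 / 16 + (1 - \<beta>) / (4 * (1 + \<beta>)) \<ge> 1 / 8"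
  proof -
    \<comment> \<open>This is the desired inequality multiplied by 16 (1 + \<beta>); completing the
      square makes the difference visibly positive.\<close>
    have "(1 + \<beta>) ^ 3 + 4 * (1 - \<beta>) \<ge> 2 * (1 + \<beta>)"
    proof -
      have "(1 + \<beta>) ^ 3 + 4 * (1 - \<beta>) - 2 * (1 + \<beta>) = \<beta> ^ 3 + 3 * (\<beta> - 1 / 2)\<^sup>2 + 9 / 4"
        by (simp add: power2_eq_square power3_eq_cube algebra_simps)
      moreover have "0 \<le> \<beta> ^ 3" "0 \<le> (\<beta> - 1 / 2)\<^sup>2" using assms by auto
      ultimately show ?thesis by linarith
    qed
    then show ?thesis using assms by (simp add: divide_simps power2_eq_square power3_eq_cube algebra_simps)
  qed
  moreover have "((1 + \<beta>) / 4)\<^sup>2 = (1 + \<beta>)\<^sup>2 / 16" by (simp add: power_divide)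
  ultimately show ?thesis using tau_emm_ge[OF assms] by linarith
qed

section \<open>Upper bounds for the coefficients of u and v\<close>

text \<open>The part free of \<sigma> is multiplied by \<sigma> (1 + \<beta>) \<ge> 1. Every upper
  bound in this group carries a factor \<sigma>, to be spent on N^2 \<sigma> \<le> R.\<close>

lemma emm_le:
  assumes "0 < a" "a \<le> 1 / 8" "0 \<le> \<beta>" "\<beta> \<le> 1" "0 < \<sigma>" "1 \<le> \<sigma> * (1 + \<beta>)"
  shows "emm a \<beta> \<sigma> \<le> \<sigma> * (1 / 2 + 2 * a * \<beta>)"
proof -
  have "a * ((1 + 2 * \<beta>) / (1 + \<beta>)) * 1 \<le> a * ((1 + 2 * \<beta>) / (1 + \<beta>)) * (\<sigma> * (1 + \<beta>))"
    using assms by (intro mult_left_mono) auto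
  moreover have "a * ((1 + 2 * \<beta>) / (1 + \<beta>)) = 2 * a - a / (1 + \<beta>)"
    "a * ((1 + 2 * \<beta>) / (1 + \<beta>)) * (\<sigma> * (1 + \<beta>)) = a * \<sigma> * (1 + 2 * \<beta>)"
    using assms by (simp_all add: field_simps)
  ultimately have "2 * a - a / (1 + \<beta>) \<le> a * \<sigma> * (1 + 2 * \<beta>)" by linarith
  then show ?thesis unfolding emm_def by (simp add: algebra_simps)
qed

lemma tau_emm_le:
  assumes "0 < a" "a \<le> 1 / 8" "0 \<le> \<beta>" "\<beta> \<le> 1" "0 < \<sigma>" "1 \<le> \<sigma> * (1 + \<beta>)" "\<tau>\<^sup>2 = 1 - \<beta>\<^sup>2"
  shows "(\<tau> * emm a \<beta> \<sigma>)\<^sup>2 \<le> \<sigma>\<^sup>2 * ((1 - \<beta>\<^sup>2) * (1 / 2 + 2 * a * \<beta>)\<^sup>2)"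
proof -
  have "0 \<le> emm a \<beta> \<sigma>" using emm_ge[OF assms(1-4,6)] assms by (smt (verit) divide_nonneg_nonneg)
  then have "(emm a \<beta> \<sigma>)\<^sup>2 \<le> (\<sigma> * (1 / 2 + 2 * a * \<beta>))\<^sup>2"
    using emm_le[OF assms(1-6)] by (intro power_mono)
  then have "(1 - \<beta>\<^sup>2) * (emm a \<beta> \<sigma>)\<^sup>2 \<le> (1 - \<beta>\<^sup>2) * (\<sigma> * (1 / 2 + 2 * a * \<beta>))\<^sup>2"
    using assms by (intro mult_left_mono) (auto simp: abs_square_le_1)
  then show ?thesis by (simp only: power_mult_distrib assms(7) mult_ac)
qed

lemma ell_le:
  assumes "0 < a" "a \<le> 1 / 8" "0 \<le> \<beta>" "\<beta> \<le> 1" "0 < \<sigma>" "\<sigma> \<le> 1" "1 \<le> \<sigma> * (1 + \<beta>)"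
  shows "ell a \<beta> \<sigma> \<le> \<sigma> * (\<beta> * (1 / 2 + a))"
proof -
  have "2 * \<beta> - 1 \<le> 2 * \<beta> * \<sigma>"
  proof (cases "2 * \<beta> \<le> 1")
    case True then show ?thesis using assms by (smt (verit) mult_nonneg_nonneg)
  next
    case False
    \<comment> \<open>The right side falls short of 2 \<beta> \<sigma> by \<sigma> (1 - \<beta>) (1
      + 2 \<beta>), which is nonnegative.\<close>
    have "(2 * \<beta> - 1) * 1 \<le> (2 * \<beta> - 1) * (\<sigma> * (1 + \<beta>))"
      using assms False by (intro mult_left_mono) auto
    moreover have "0 \<le> \<sigma> * ((1 - \<beta>) * (1 + 2 * \<beta>))" using assms by simp
    ultimately show ?thesis by (simp add: algebra_simps)
  qed
  then have "a * (2 * \<beta> - 1) \<le> a * (2 * \<beta> * \<sigma>)" using assms by (intro mult_left_mono) auto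
  then show ?thesis unfolding ell_def by (simp add: algebra_simps)
qed

lemma ell_ge_neg_sigma:
  assumes "0 < a" "a \<le> 1 / 8" "0 \<le> \<beta>" "\<beta> \<le> 1" "0 < \<sigma>" "1 \<le> \<sigma> * (1 + \<beta>)"
  shows "- (a * \<sigma>) \<le> ell a \<beta> \<sigma>"
proof -
  have "a / (1 + \<beta>) \<le> a * \<sigma>"
    using assms mult_left_mono[OF assms(6), of a] by (simp add: field_simps)
  then show ?thesis using ell_ge_neg[OF assms(1-4,6)] by linarith
qed

text \<open>Squaring needs a bound on the absolute value of \<open>ell\<close>, hence the split by
  sign. If \<open>ell\<close> is nonnegative, the estimate is a convex combination with weights
  \<beta>^2 and 1 - \<beta>^2 of two numbers below the target. If it is negative, then \<beta> \<le>
  1/2, which sharpens the \<open>emm\<close> term, and \<open>ell\<close> is at most a \<sigma> in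
  absolute value.\<close>

lemma v_coefficient_upper:
  assumes "0 < a" "a \<le> 1 / 8" "0 \<le> \<beta>" "\<beta> \<le> 1" "0 < \<sigma>" "\<sigma> \<le> 1" "1 \<le> \<sigma> * (1 + \<beta>)" "\<tau>\<^sup>2 = 1 - \<beta>\<^sup>2"
  shows "(ell a \<beta> \<sigma>)\<^sup>2 + (\<tau> * emm a \<beta> \<sigma>)\<^sup>2 \<le> \<sigma>\<^sup>2 * ((1 + 2 * a)\<^sup>2 / 2)"
proof -
  have T: "(\<tau> * emm a \<beta> \<sigma>)\<^sup>2 \<le> \<sigma>\<^sup>2 * ((1 - \<beta>\<^sup>2) * (1 / 2 + 2 * a * \<beta>)\<^sup>2)"
    using assms by (intro tau_emm_le)
  have b2: "0 \<le> 1 - \<beta>\<^sup>2" using assms by (simp add: abs_square_le_1)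
  show ?thesis
  proof (cases "0 \<le> ell a \<beta> \<sigma>")
    case True
    then have E: "(ell a \<beta> \<sigma>)\<^sup>2 \<le> \<sigma>\<^sup>2 * (\<beta>\<^sup>2 * (1 / 2 + a)\<^sup>2)"
      unfolding power_mult_distrib[symmetric]
      using ell_le[OF assms(1-7)] by (intro power_mono)
    have "(1 / 2 + 2 * a * \<beta>)\<^sup>2 \<le> (1 / 2 + 2 * a * 1)\<^sup>2"
      using assms by (intro power_mono add_left_mono mult_left_mono) auto
    \<comment> \<open>After expansion this says a^2 \<le> 1/8.\<close>
    also have "\<dots> \<le> (1 + 2 * a)\<^sup>2 / 2"
      using mult_mono[OF assms(2) assms(2)] assms by (simp add: power2_eq_square algebra_simps)
    finally have "(1 - \<beta>\<^sup>2) * (1 / 2 + 2 * a * \<beta>)\<^sup>2 \<le> (1 - \<beta>\<^sup>2) * ((1 + 2 * a)\<^sup>2 / 2)"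
      by (rule mult_left_mono[OF _ b2])
    moreover have "\<beta>\<^sup>2 * (1 / 2 + a)\<^sup>2 \<le> \<beta>\<^sup>2 * ((1 + 2 * a)\<^sup>2 / 2)"
      using assms by (intro mult_left_mono) (auto simp: power2_eq_square algebra_simps)
    ultimately have "\<beta>\<^sup>2 * (1 / 2 + a)\<^sup>2 + (1 - \<beta>\<^sup>2) * (1 / 2 + 2 * a * \<beta>)\<^sup>2 \<le> (1 + 2 * a)\<^sup>2 / 2"
      by (simp add: algebra_simps)
    then have "\<sigma>\<^sup>2 * (\<beta>\<^sup>2 * (1 / 2 + a)\<^sup>2 + (1 - \<beta>\<^sup>2) * (1 / 2 + 2 * a * \<beta>)\<^sup>2) \<le> \<sigma>\<^sup>2 * ((1 + 2 * a)\<^sup>2 / 2)"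
      by (rule mult_left_mono) simp
    with E T show ?thesis unfolding distrib_left by linarith
  next
    case False
    have b: "\<beta> \<le> 1 / 2"
    proof (rule ccontr)
      assume "\<not> \<beta> \<le> 1 / 2"
      then have "0 \<le> a * (2 * \<beta> - 1)" "0 \<le> (1 / 2 - a) * \<beta> * \<sigma>" using assms by auto
      then show False using False by (simp add: ell_def algebra_simps)
    qed
    have "(- ell a \<beta> \<sigma>)\<^sup>2 \<le> (a * \<sigma>)\<^sup>2"
      using ell_ge_neg_sigma[OF assms(1-5,7)] False by (intro power_mono) auto
    then have E: "(ell a \<beta> \<sigma>)\<^sup>2 \<le> \<sigma>\<^sup>2 * a\<^sup>2" by (simp add: power_mult_distrib algebra_simps)
    have "(1 - \<beta>\<^sup>2) * (1 / 2 + 2 * a * \<beta>)\<^sup>2 \<le> 1 * (1 / 2 + 2 * a * (1 / 2))\<^sup>2"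
      using assms b by (intro mult_mono power_mono add_left_mono mult_left_mono) auto
    \<comment> \<open>The right side is twice (1/2 + a)^2, so the claim is a^2 \<le> (1/2 +
      a)^2.\<close>
    moreover have "a\<^sup>2 + 1 * (1 / 2 + 2 * a * (1 / 2))\<^sup>2 \<le> (1 + 2 * a)\<^sup>2 / 2"
      using assms by (simp add: power2_eq_square algebra_simps)
    ultimately have "a\<^sup>2 + (1 - \<beta>\<^sup>2) * (1 / 2 + 2 * a * \<beta>)\<^sup>2 \<le> (1 + 2 * a)\<^sup>2 / 2"
      by linarith
    then have "\<sigma>\<^sup>2 * (a\<^sup>2 + (1 - \<beta>\<^sup>2) * (1 / 2 + 2 * a * \<beta>)\<^sup>2) \<le> \<sigma>\<^sup>2 * ((1 + 2 * a)\<^sup>2 / 2)"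
      by (rule mult_left_mono) simp
    with E T show ?thesis unfolding distrib_left by linarith
  qed
qed

text \<open>Each of the two squares is at most \<sigma>^2, so a quarter of their sum is at most
  \<sigma>^2 / 2.\<close>

lemma u_coefficient_upper:
  assumes "0 < a" "a \<le> 1 / 8" "0 \<le> \<beta>" "\<beta> \<le> 1" "0 < \<sigma>" "\<sigma> \<le> 1" "1 \<le> \<sigma> * (1 + \<beta>)" "\<tau>\<^sup>2 = 1 - \<beta>\<^sup>2"
  shows "((ell a \<beta> \<sigma> + (1 / 2 - a) * \<sigma>)\<^sup>2 + (\<tau> * emm a \<beta> \<sigma>)\<^sup>2) / 4 \<le> \<sigma>\<^sup>2 * ((1 + 2 * a)\<^sup>2 / 2)"
proof -
  have T: "(\<tau> * emm a \<beta> \<sigma>)\<^sup>2 \<le> \<sigma>\<^sup>2 * ((1 - \<beta>\<^sup>2) * (1 / 2 + 2 * a * \<beta>)\<^sup>2)"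
    using assms by (intro tau_emm_le)
  have ab: "a * \<beta> \<le> 1 / 8 * 1" using assms by (intro mult_mono) auto
  have "(1 - \<beta>\<^sup>2) * (1 / 2 + 2 * a * \<beta>)\<^sup>2 \<le> 1 * 1\<^sup>2"
    using assms ab by (intro mult_mono power_mono) auto
  then have "\<sigma>\<^sup>2 * ((1 - \<beta>\<^sup>2) * (1 / 2 + 2 * a * \<beta>)\<^sup>2) \<le> \<sigma>\<^sup>2 * 1"
    by (intro mult_left_mono) auto
  moreover have "\<beta> * (1 / 2 + a) \<le> 1 * (1 / 2 + a)" using assms by (intro mult_right_mono) auto
  then have "\<sigma> * (\<beta> * (1 / 2 + a)) \<le> \<sigma> * (1 * (1 / 2 + a))" using assms by (intro mult_left_mono) auto
  then have "ell a \<beta> \<sigma> + (1 / 2 - a) * \<sigma> \<le> \<sigma>"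
    using ell_le[OF assms(1-7)] by (simp add: algebra_simps)
  then have "(ell a \<beta> \<sigma> + (1 / 2 - a) * \<sigma>)\<^sup>2 \<le> \<sigma>\<^sup>2"
    using ell_plus_sigma_ge[OF assms(1-4,7)] assms by (intro power_mono) auto
  moreover have "\<sigma>\<^sup>2 * 1 \<le> \<sigma>\<^sup>2 * (1 + 2 * a)\<^sup>2"
    using assms by (intro mult_left_mono) auto
  ultimately show ?thesis using T by simp
qed

section \<open>Expressing N in the reduced variables\<close>

definition U_fun :: "nat \<Rightarrow> (nat \<Rightarrow> real) \<Rightarrow> real" where
  "U_fun n x = (x 1)\<^sup>2 + (x (n + 1))\<^sup>2"

definition V_fun :: "nat \<Rightarrow> (nat \<Rightarrow> real) \<Rightarrow> real" where
  "V_fun n x = (\<Sum>j\<in>{2..2*n} - {n + 1}. (x j)\<^sup>2)"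

lemma R_fun_squared: "(R_fun u v t)\<^sup>2 = (u / 4 + v / 2)\<^sup>2 + t\<^sup>2"
  by (simp add: R_fun_def)

lemma R_fun_ge: "u / 4 + v / 2 \<le> R_fun u v t"
  by (simp add: R_fun_def real_le_rsqrt)

lemma N_fun_eq: "N_fun n x t = G_fun (1 / (4 * real n)) (U_fun n x) (V_fun n x) t"
proof -
  define u v where "u = U_fun n x" and "v = V_fun n x"
  define B R a where "B = u / 4 + v / 2" and "R = R_fun u v t" and "a = 1 / (4 * real n)"
  have uv: "0 \<le> u" "0 \<le> v" by (auto simp: u_def v_def U_fun_def V_fun_def intro: sum_nonneg)
  then have B: "0 \<le> B" "B \<le> R" by (auto simp: B_def R_def R_fun_ge)
  have R2: "B\<^sup>2 + t\<^sup>2 = R\<^sup>2" by (simp add: R_def B_def R_fun_squared)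
  have sq: "sqrt (B\<^sup>2 + t\<^sup>2) = R" using R2 B by simp
  have AB: "A_fun n x = B + u / 4" "B_fun n x = B"
    by (auto simp: A_fun_def B_fun_def B_def u_def v_def U_fun_def V_fun_def field_simps)
  have t2: "t\<^sup>2 = R\<^sup>2 - B\<^sup>2" using R2 by simp
  have prod: "(B + u / 4) * B + t\<^sup>2 + (B + u / 4) * R = (R + B) * (R + u / 4)"
    unfolding t2 by (simp add: power2_eq_square algebra_simps)
  have N: "N_fun n x t = (R\<^sup>2) powr a * ((R + B) * (R + u / 4)) powr (1 / 2 - a) / (R + B) powr (1 / 2)"
    unfolding N_fun_def AB Let_def sq prod unfolding R2 a_def by (simp only: add.commute[of B R])
  have "R\<^sup>2 = R powr 2" using B by (simp add: powr_numeral)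
  then have "(R\<^sup>2) powr a = R powr (2 * a)" by (simp add: powr_powr)
  moreover have "((R + B) * (R + u / 4)) powr (1 / 2 - a) = (R + B) powr (1 / 2 - a) * (R + u / 4) powr (1 / 2 - a)"
    using B uv by (simp add: powr_mult)
  moreover have "(R + B) powr (- a) = (R + B) powr (1 / 2 - a) / (R + B) powr (1 / 2)"
    by (simp flip: powr_diff)
  ultimately show ?thesis
    unfolding N G_fun_def u_def[symmetric] v_def[symmetric] R_def[symmetric] a_def[symmetric] B_def[symmetric]
    by simp
qed

section \<open>Differentiating the reduced norm\<close>

text \<open>Taken along an arbitrary curve (p, q, r), so that one rule serves every coordinate line
  in x as well as the t-direction.\<close>

lemma DERIV_R_fun:
  assumes "(p has_real_derivative p') (at s)" "(q has_real_derivative q') (at s)"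
    "(r has_real_derivative r') (at s)" "0 < R_fun (p s) (q s) (r s)"
  shows "((\<lambda>s. R_fun (p s) (q s) (r s)) has_real_derivative
    ((p s / 4 + q s / 2) * (p' / 4 + q' / 2) + r s * r') / R_fun (p s) (q s) (r s)) (at s)"
proof -
  have pos: "0 < (p s / 4 + q s / 2)\<^sup>2 + (r s)\<^sup>2" using assms(4) by (simp add: R_fun_def)
  have d: "((\<lambda>s. (p s / 4 + q s / 2)\<^sup>2 + (r s)\<^sup>2) has_real_derivative
    2 * ((p s / 4 + q s / 2) * (p' / 4 + q' / 2) + r s * r')) (at s)"
    using assms(1-3) by (auto intro!: derivative_eq_intros simp: algebra_simps)
  have e: "inverse S / 2 * (2 * E) = E / S" for S E :: real
    by (cases "S = 0") (simp_all add: field_simps)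
  show ?thesis
    using DERIV_chain2[OF DERIV_real_sqrt[OF pos] d] unfolding R_fun_def e .
qed

text \<open>The left side is the weighted sum of logarithmic derivatives of R, R (1 + \<beta>) and R
  / \<sigma>, where R has derivative \<beta> B' + \<tau> r'; the right side collects the
  coefficients of p', q' and r'.\<close>

lemma log_derivative_eq:
  fixes R \<beta> \<sigma> \<tau> :: real
  assumes "R \<noteq> 0" "1 + \<beta> \<noteq> 0" "\<sigma> \<noteq> 0" and B': "B' = p' / 4 + q' / 2"
  shows "2 * a * (\<beta> * B' + \<tau> * r') / R + - a * (\<beta> * B' + \<tau> * r' + B') / (R * (1 + \<beta>))
      + (1 / 2 - a) * (\<beta> * B' + \<tau> * r' + p' / 4) / (R / \<sigma>)
    = (ell a \<beta> \<sigma> + (1 / 2 - a) * \<sigma>) / (4 * R) * p' + ell a \<beta> \<sigma> / (2 * R) * q' + \<tau> * emm a \<beta> \<sigma> / R * r'"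
proof -
  have "- a * (\<beta> * B' + \<tau> * r' + B') / (R * (1 + \<beta>)) = - a * B' / R - \<tau> * r' / R * (a / (1 + \<beta>))"
    using assms(1,2) by (simp add: divide_simps) (simp add: algebra_simps)
  moreover have "ell a \<beta> \<sigma> / (4 * R) * p' + ell a \<beta> \<sigma> / (2 * R) * q' = ell a \<beta> \<sigma> * B' / R"
    using assms(1) by (simp add: B' field_simps)
  ultimately show ?thesis
    unfolding ell_def emm_def using assms(1,3)
    by (simp add: algebra_simps add_divide_distrib diff_divide_distrib)
qed

lemma DERIV_G_fun:
  fixes p q r :: "real \<Rightarrow> real"
  assumes d: "(p has_real_derivative p') (at s)" "(q has_real_derivative q') (at s)"
      "(r has_real_derivative r') (at s)"
    and nn: "0 \<le> p s" "0 \<le> q s" and R: "R = R_fun (p s) (q s) (r s)" "0 < R"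
    and \<beta>: "\<beta> = (p s / 4 + q s / 2) / R" and \<sigma>: "\<sigma> = R / (R + p s / 4)" and \<tau>: "\<tau> = r s / R"
  shows "((\<lambda>s. G_fun a (p s) (q s) (r s)) has_real_derivative
    G_fun a (p s) (q s) (r s) * ((ell a \<beta> \<sigma> + (1 / 2 - a) * \<sigma>) / (4 * R) * p'
      + ell a \<beta> \<sigma> / (2 * R) * q' + \<tau> * emm a \<beta> \<sigma> / R * r')) (at s)"
proof -
  define B' where "B' = p' / 4 + q' / 2"
  define R' where "R' = \<beta> * B' + \<tau> * r'"
  have dR: "((\<lambda>s. R_fun (p s) (q s) (r s)) has_real_derivative R') (at s)"
    using DERIV_R_fun[OF d] R by (simp add: R'_def B'_def \<beta> \<tau> add_divide_distrib[of "_ * _"])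
  have dP: "((\<lambda>s. R_fun (p s) (q s) (r s) + (p s / 4 + q s / 2)) has_real_derivative R' + B') (at s)"
    unfolding B'_def by (intro DERIV_add dR DERIV_cdivide d)
  have dS: "((\<lambda>s. R_fun (p s) (q s) (r s) + p s / 4) has_real_derivative R' + p' / 4) (at s)"
    by (intro DERIV_add dR DERIV_cdivide d)
  have P: "R + (p s / 4 + q s / 2) = R * (1 + \<beta>)" and S: "R + p s / 4 = R / \<sigma>"
    using R nn by (auto simp: \<beta> \<sigma> field_simps)
  have \<beta>\<sigma>: "0 \<le> \<beta>" "0 < \<sigma>" using R nn by (auto simp: \<beta> \<sigma>)
  have pos: "0 < R_fun (p s) (q s) (r s)" "0 < R_fun (p s) (q s) (r s) + (p s / 4 + q s / 2)"
    "0 < R_fun (p s) (q s) (r s) + p s / 4" using R nn by auto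
  have eq: "2 * a * R' / R + - a * (R' + B') / (R + (p s / 4 + q s / 2))
      + (1 / 2 - a) * (R' + p' / 4) / (R + p s / 4)
    = (ell a \<beta> \<sigma> + (1 / 2 - a) * \<sigma>) / (4 * R) * p' + ell a \<beta> \<sigma> / (2 * R) * q' + \<tau> * emm a \<beta> \<sigma> / R * r'"
    unfolding P S R'_def using R \<beta>\<sigma> by (intro log_derivative_eq) (auto simp: B'_def)
  show ?thesis
    using DERIV_powr_product[OF dR dP dS pos, of "2 * a" "- a" "1 / 2 - a"]
    unfolding R(1)[symmetric] eq unfolding G_fun_def R(1)[symmetric] .
qed

section \<open>Size of the norm compared with R\<close>

text \<open>With P = R + B and S = R + u/4, one has R \<le> S \<le> P \<le> 2R, and the square of
  \<open>G_fun\<close> is a monomial in R, P, S with exponents 4a, -2a, 1 - 2a of sum 1. Bounding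
  R^(4a) by P^(2a) S^(2a) leaves S; bounding P by 2R and S below by R leaves 2^(-2a) R.\<close>

lemma G_fun_bounds:
  assumes a: "0 < a" "a \<le> 1 / 8" and nn: "0 \<le> u" "0 \<le> v" and R: "R = R_fun u v t" "0 < R"
  shows "0 < G_fun a u v t" "(G_fun a u v t)\<^sup>2 \<le> R + u / 4" "R\<^sup>2 \<le> 2 powr (8 * a) * ((G_fun a u v t)\<^sup>2)\<^sup>2"
proof -
  define P S where "P = R + (u / 4 + v / 2)" and "S = R + u / 4"
  have B: "u / 4 + v / 2 \<le> R" by (simp add: R R_fun_ge)
  have PS: "R \<le> S" "S \<le> P" "P \<le> 2 * R" using nn B by (auto simp: P_def S_def)
  have pos: "0 < S" "0 < P" using PS R by auto
  have G: "G_fun a u v t = R powr (2 * a) * P powr (- a) * S powr (1 / 2 - a)"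
    by (simp add: G_fun_def P_def S_def R)
  show "0 < G_fun a u v t" using R pos by (simp add: G)
  have sq: "(y powr c)\<^sup>2 = y powr (2 * c)" for y c :: real
    by (simp add: power2_eq_square flip: powr_add)
  have G2: "(G_fun a u v t)\<^sup>2 = R powr (4 * a) * P powr (- (2 * a)) * S powr (1 - 2 * a)"
    unfolding G power_mult_distrib sq by (simp add: algebra_simps)
  have "R powr (4 * a) = R powr (2 * a) * R powr (2 * a)" by (simp flip: powr_add)
  also have "\<dots> \<le> P powr (2 * a) * S powr (2 * a)"
    using a R PS by (intro mult_mono powr_mono2) auto
  finally have "R powr (4 * a) * (P powr (- (2 * a)) * S powr (1 - 2 * a))
      \<le> P powr (2 * a) * S powr (2 * a) * (P powr (- (2 * a)) * S powr (1 - 2 * a))"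
    by (rule mult_right_mono) simp
  also have "\<dots> = (P powr (2 * a) * P powr (- (2 * a))) * (S powr (2 * a) * S powr (1 - 2 * a))"
    by (simp only: mult_ac)
  also have "\<dots> = S" using pos by (simp flip: powr_add)
  finally show "(G_fun a u v t)\<^sup>2 \<le> R + u / 4" by (simp add: G2 S_def mult.assoc)
  have "(2 * R) powr (- (2 * a)) \<le> P powr (- (2 * a))"
    using a pos PS by (intro powr_mono2') auto
  moreover have "R powr (1 - 2 * a) \<le> S powr (1 - 2 * a)"
    using a R PS by (intro powr_mono2) auto
  ultimately have "R powr (4 * a) * (2 * R) powr (- (2 * a)) * R powr (1 - 2 * a) \<le> (G_fun a u v t)\<^sup>2"
    unfolding G2 by (intro mult_mono) auto
  moreover have "R powr (4 * a) * (2 * R) powr (- (2 * a)) * R powr (1 - 2 * a)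
      = 2 powr (- (2 * a)) * (R powr (4 * a) * R powr (- (2 * a)) * R powr (1 - 2 * a))"
    using R by (simp add: powr_mult)
  moreover have "R powr (4 * a) * R powr (- (2 * a)) * R powr (1 - 2 * a) = R"
    using R by (simp flip: powr_add)
  ultimately have "2 powr (- (2 * a)) * R \<le> (G_fun a u v t)\<^sup>2" by simp
  then have "(2 powr (- (2 * a)) * R)\<^sup>2 \<le> ((G_fun a u v t)\<^sup>2)\<^sup>2" using R by (intro power_mono) auto
  then have "2 powr (- (4 * a)) * R\<^sup>2 \<le> ((G_fun a u v t)\<^sup>2)\<^sup>2"
    by (simp add: power_mult_distrib sq)
  \<comment> \<open>The previous line allows the factor 2^(4a); it is relaxed to 2^(8a), which is
    2^(2/n) for a = 1 / (4n).\<close>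
  then have "2 powr (8 * a) * (2 powr (- (4 * a)) * R\<^sup>2) \<le> 2 powr (8 * a) * ((G_fun a u v t)\<^sup>2)\<^sup>2"
    by (intro mult_left_mono) auto
  moreover have "2 powr (8 * a) * (2 powr (- (4 * a)) * R\<^sup>2) = 2 powr (4 * a) * R\<^sup>2"
    by (simp flip: powr_add mult.assoc)
  moreover have "1 * R\<^sup>2 \<le> 2 powr (4 * a) * R\<^sup>2"
    using a by (intro mult_right_mono ge_one_powr_ge_zero) auto
  ultimately show "R\<^sup>2 \<le> 2 powr (8 * a) * ((G_fun a u v t)\<^sup>2)\<^sup>2" by simp
qed

section \<open>Pairing the coordinates in the vector fields\<close>

lemma sum_pairs_tail:
  fixes f :: "nat \<Rightarrow> real"
  shows "sum f ({2..2*n} - {n + 1}) = (\<Sum>j=2..n. f j + f (j + n))"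
proof -
  have "{2..2*n} - {n + 1} = {2..n} \<union> {2 + n..n + n}" by auto
  moreover have "sum f {2 + n..n + n} = (\<Sum>j=2..n. f (j + n))" by (rule sum.shift_bounds_cl_nat_ivl)
  ultimately show ?thesis by (simp add: sum.union_disjoint sum.distrib)
qed

lemma sum_pairs:
  fixes f :: "nat \<Rightarrow> real"
  assumes "1 \<le> n"
  shows "sum f {1..2*n} = f 1 + f (n + 1) + (\<Sum>j=2..n. f j + f (j + n))"
proof -
  have "{1..2*n} = insert 1 (insert (n + 1) ({2..2*n} - {n + 1}))" using assms by auto
  moreover have "1 \<notin> insert (n + 1) ({2..2*n} - {n + 1})" "n + 1 \<notin> {2..2*n} - {n + 1}"
    using assms by auto
  ultimately have "sum f {1..2*n} = f 1 + (f (n + 1) + sum f ({2..2*n} - {n + 1}))"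
    by (simp only: sum.insert finite_insert finite_Diff finite_atLeastAtMost not_False_eq_True)
  then show ?thesis by (simp only: sum_pairs_tail add.assoc)
qed

lemma U_fun_DERIV:
  assumes "1 \<le> n"
  shows "((\<lambda>s. U_fun n (x(j := s))) has_real_derivative (if j \<in> {1, n + 1} then 2 * x j else 0)) (at (x j))"
proof -
  have "((\<lambda>s. (x(j := s)) i ^ 2) has_real_derivative (if i = j then 2 * x j else 0)) (at (x j))" for i
    by (cases "i = j") (auto intro!: derivative_eq_intros)
  from DERIV_add[OF this[of 1] this[of "n + 1"]] show ?thesis
    unfolding U_fun_def by (rule DERIV_cong) (use assms in auto)
qed

lemma V_fun_DERIV:
  "((\<lambda>s. V_fun n (x(j := s))) has_real_derivative
    (if j \<in> {2..2*n} - {n + 1} then 2 * x j else 0)) (at (x j))"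
proof -
  have "((\<lambda>s. V_fun n (x(j := s))) has_real_derivative
    (\<Sum>i\<in>{2..2*n} - {n + 1}. if i = j then 2 * x j else 0)) (at (x j))"
    unfolding V_fun_def by (rule DERIV_sum) (auto intro!: derivative_eq_intros)
  then show ?thesis by simp
qed

text \<open>For a pair j, j + n the fields take the values q x_j - x_(j+n) T and q x_(j+n) + x_j T,
  a rotation with scaling of (x_j, x_(j+n)), so mixed products cancel in both sums. The first pair
  has T / 2 in place of T, hence T^2 / 4.\<close>

lemma subgrad_of_partials:
  assumes n: "1 \<le> n"
    and pu: "\<And>j. j \<in> {1, n + 1} \<Longrightarrow> partial_x j f x t = p * x j"
    and pv: "\<And>j. j \<in> {2..2*n} - {n + 1} \<Longrightarrow> partial_x j f x t = q * x j"
    and pt: "partial_t f x t = T"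
  shows "x_dot_subgrad n f x t = p * U_fun n x + q * V_fun n x"
    and "subgrad_norm_sq n f x t = (p\<^sup>2 + T\<^sup>2 / 4) * U_fun n x + (q\<^sup>2 + T\<^sup>2) * V_fun n x"
proof -
  have v1: "vfield n 1 f x t = p * x 1 - x (n + 1) / 2 * T"
    "vfield n (n + 1) f x t = p * x (n + 1) + x 1 / 2 * T"
    using n by (auto simp: vfield_def pt pu)
  have v2: "vfield n j f x t = q * x j - x (j + n) * T"
    "vfield n (j + n) f x t = q * x (j + n) + x j * T" if "j \<in> {2..n}" for j
    using that pv[of j] pv[of "j + n"] by (auto simp: vfield_def pt)
  have "x_dot_subgrad n f x t = p * U_fun n x + (\<Sum>j=2..n. q * ((x j)\<^sup>2 + (x (j + n))\<^sup>2))"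
    unfolding x_dot_subgrad_def sum_pairs[OF n] v1
    by (intro arg_cong2[where f = "(+)"] sum.cong refl)
      (auto simp: v2 U_fun_def power2_eq_square algebra_simps)
  then show "x_dot_subgrad n f x t = p * U_fun n x + q * V_fun n x"
    unfolding V_fun_def sum_pairs_tail sum_distrib_left .
  have "subgrad_norm_sq n f x t = (p\<^sup>2 + T\<^sup>2 / 4) * U_fun n x
      + (\<Sum>j=2..n. (q\<^sup>2 + T\<^sup>2) * ((x j)\<^sup>2 + (x (j + n))\<^sup>2))"
    unfolding subgrad_norm_sq_def sum_pairs[OF n] v1
    by (intro arg_cong2[where f = "(+)"] sum.cong refl)
      (auto simp: v2 U_fun_def power2_eq_square algebra_simps)
  then show "subgrad_norm_sq n f x t = (p\<^sup>2 + T\<^sup>2 / 4) * U_fun n x + (q\<^sup>2 + T\<^sup>2) * V_fun n x"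
    unfolding V_fun_def sum_pairs_tail sum_distrib_left .
qed

section \<open>Assembling the three inequalities\<close>

theorem lemma2:
  fixes n :: nat and x :: "nat \<Rightarrow> real" and t :: real
  assumes "n \<ge> 2"
    and "\<not> ((\<forall>j\<in>{1..2*n}. x j = 0) \<and> t = 0)"
  shows "x_dot_subgrad n (N_fun n) x t \<ge> - ((xnorm n x)\<^sup>2 / (4 * real n * N_fun n x t))
    \<and> subgrad_norm_sq n (N_fun n) x t \<ge> (xnorm n x)\<^sup>2 / (2 powr (5 + 2 / real n) * (N_fun n x t)\<^sup>2)
    \<and> subgrad_norm_sq n (N_fun n) x t
        \<le> (2 * real n + 1)\<^sup>2 * (xnorm n x)\<^sup>2 / (2 ^ 3 * (real n)\<^sup>2 * (N_fun n x t)\<^sup>2)"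
proof -
  define a u v where "a = 1 / (4 * real n)" and "u = U_fun n x" and "v = V_fun n x"
  define R where "R = R_fun u v t"
  define \<beta> \<sigma> \<tau> where "\<beta> = (u / 4 + v / 2) / R" and "\<sigma> = R / (R + u / 4)" and "\<tau> = t / R"
  define l m N where "l = ell a \<beta> \<sigma>" and "m = emm a \<beta> \<sigma>" and "N = N_fun n x t"
  have n: "1 \<le> n" using assms by simp
  have a: "0 < a" "a \<le> 1 / 8" using assms by (auto simp: a_def field_simps)
  have uv: "0 \<le> u" "0 \<le> v" by (auto simp: u_def v_def U_fun_def V_fun_def intro: sum_nonneg)
  have xn: "(xnorm n x)\<^sup>2 = u + v"
    unfolding xnorm_def u_def v_def U_fun_def V_fun_def sum_pairs[OF n] sum_pairs_tail
    by (simp add: sum_nonneg)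
  have R: "0 < R"
  proof (rule ccontr)
    assume "\<not> 0 < R"
    then have "(u / 4 + v / 2)\<^sup>2 + t\<^sup>2 \<le> 0" by (simp add: R_def R_fun_def)
    then have "u / 4 + v / 2 = 0" "t = 0" by (simp_all add: sum_power2_le_zero_iff)
    then have "(\<Sum>j=1..2*n. (x j)\<^sup>2) = 0" "t = 0"
      using xn uv by (auto simp: xnorm_def sum_nonneg)
    then show False using assms(2) by (simp add: sum_nonneg_eq_0_iff)
  qed
  have B: "u / 4 + v / 2 \<le> R" by (simp add: R_def R_fun_ge)
  have \<beta>: "0 \<le> \<beta>" "\<beta> \<le> 1" using uv R B by (auto simp: \<beta>_def)
  have \<sigma>: "0 < \<sigma>" "\<sigma> \<le> 1" using uv R by (auto simp: \<sigma>_def field_simps)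
  have P: "R + (u / 4 + v / 2) = R * (1 + \<beta>)" and S: "R + u / 4 = R / \<sigma>"
    using R uv by (auto simp: \<beta>_def \<sigma>_def field_simps)
  have "R / \<sigma> \<le> R * (1 + \<beta>)" using uv by (simp flip: P S)
  then have "R * 1 \<le> R * (\<sigma> * (1 + \<beta>))" using \<sigma> by (simp add: field_simps)
  then have \<sigma>\<beta>: "1 \<le> \<sigma> * (1 + \<beta>)" using R by (simp only: mult_le_cancel_left_pos)
  have "t\<^sup>2 = R\<^sup>2 - (u / 4 + v / 2)\<^sup>2" by (simp add: R_def R_fun_squared)
  then have \<tau>: "\<tau>\<^sup>2 = 1 - \<beta>\<^sup>2" using R by (simp add: \<tau>_def \<beta>_def power_divide field_simps)
  have NG: "N = G_fun a u v t" by (simp add: N_def N_fun_eq a_def u_def v_def)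
  have N: "0 < N" "N\<^sup>2 \<le> R / \<sigma>" "R\<^sup>2 \<le> 2 powr (8 * a) * (N\<^sup>2)\<^sup>2"
    using G_fun_bounds[OF a uv R_def R] by (simp_all add: NG S)
  \<comment> \<open>\<open>D\<close> is the differential of \<open>G_fun a\<close> at (u, v, t),
    applied to the velocities of u, v and t along a curve.\<close>
  define D where "D = (\<lambda>p' q' r'. N * ((l + (1 / 2 - a) * \<sigma>) / (4 * R) * p'
      + l / (2 * R) * q' + \<tau> * m / R * r'))"
  have dG: "((\<lambda>s. G_fun a (f s) (g s) (h s)) has_real_derivative D p' q' r') (at s)"
    if "(f has_real_derivative p') (at s)" "(g has_real_derivative q') (at s)"
      "(h has_real_derivative r') (at s)" and eq: "f s = u" "g s = v" "h s = t"
    for f g h p' q' r' s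
    unfolding D_def NG l_def m_def eq[symmetric]
    by (rule DERIV_G_fun[OF that(1-3)]) (use uv R eq in \<open>simp_all add: R_def \<beta>_def \<sigma>_def \<tau>_def\<close>)
  have dx: "partial_x j (N_fun n) x t = D (if j \<in> {1, n + 1} then 2 * x j else 0)
      (if j \<in> {2..2*n} - {n + 1} then 2 * x j else 0) 0" for j
    unfolding partial_x_def N_fun_eq a_def[symmetric]
    by (rule DERIV_imp_deriv, rule dG[OF U_fun_DERIV[OF n] V_fun_DERIV DERIV_const])
      (simp_all add: u_def v_def)
  have dt: "partial_t (N_fun n) x t = D 0 0 1"
    unfolding partial_t_def N_fun_eq a_def[symmetric]
    by (rule DERIV_imp_deriv, rule dG[OF DERIV_const DERIV_const DERIV_ident])
      (simp_all add: u_def v_def)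
  define p q T where "p = N * (l + (1 / 2 - a) * \<sigma>) / (2 * R)" and "q = N * l / R" and "T = N * (\<tau> * m) / R"
  have D: "D (2 * y) 0 0 = p * y" "D 0 (2 * y) 0 = q * y" "D 0 0 1 = T" for y
  proof -
    show "D (2 * y) 0 0 = p * y"
      unfolding D_def p_def using R by (simp add: divide_simps)
  qed (simp_all add: D_def q_def T_def)
  have pu: "partial_x j (N_fun n) x t = p * x j" if "j \<in> {1, n + 1}" for j
  proof -
    have "j \<notin> {2..2*n} - {n + 1}" using that by auto
    then show ?thesis using that by (simp only: dx if_True if_False D)
  qed
  have pv: "partial_x j (N_fun n) x t = q * x j" if "j \<in> {2..2*n} - {n + 1}" for j
  proof -
    have "j \<notin> {1, n + 1}" using that by auto
    then show ?thesis using that by (simp only: dx if_True if_False D)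
  qed
  have pt: "partial_t (N_fun n) x t = T" by (simp only: dt D)
  have grad: "x_dot_subgrad n (N_fun n) x t = p * u + q * v"
    "subgrad_norm_sq n (N_fun n) x t = (p\<^sup>2 + T\<^sup>2 / 4) * u + (q\<^sup>2 + T\<^sup>2) * v"
    unfolding u_def v_def by (rule subgrad_of_partials[OF n]; fact pu pv pt)+
  \<comment> \<open>The common factor 1/4 comes from the 2R in the denominator of \<open>p\<close>
    and from the halved T on the first pair.\<close>
  have pT: "p\<^sup>2 + T\<^sup>2 / 4 = N\<^sup>2 / R\<^sup>2 * (((l + (1 / 2 - a) * \<sigma>)\<^sup>2 + (\<tau> * m)\<^sup>2) / 4)"
    and qT: "q\<^sup>2 + T\<^sup>2 = N\<^sup>2 / R\<^sup>2 * (l\<^sup>2 + (\<tau> * m)\<^sup>2)"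
    unfolding p_def q_def T_def power_divide power_mult_distrib[of N]
    by (simp_all add: add_divide_distrib distrib_left)
  have NR: "0 \<le> N\<^sup>2 / R\<^sup>2" by simp

  \<comment> \<open>From N^2 \<le> R (1 + \<beta>), the factor N / (R (1 + \<beta>)) is at most 1 /
    N; and a / N is 1 / (4nN).\<close>
  have "- (a / N) \<le> q"
  proof -
    have "N\<^sup>2 \<le> R * (1 + \<beta>)" using N(2) \<open>R / \<sigma> \<le> R * (1 + \<beta>)\<close> by simp
    then have "N * a / (R * (1 + \<beta>)) \<le> N * a / N\<^sup>2"
      using a N R \<beta> by (intro divide_left_mono) auto
    then have "N / R * (a / (1 + \<beta>)) \<le> a / N" using N by (simp add: power2_eq_square)
    moreover have "N / R * (- (a / (1 + \<beta>))) \<le> N / R * l"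
      unfolding l_def using N R ell_ge_neg[OF a \<beta> \<sigma>\<beta>] by (intro mult_left_mono) auto
    ultimately show ?thesis by (simp add: q_def)
  qed
  moreover have "- (a / N) \<le> p"
  proof -
    have "0 \<le> p" unfolding p_def l_def using N R \<beta> ell_plus_sigma_ge[OF a \<beta> \<sigma>\<beta>] by simp
    moreover have "0 \<le> a / N" using a N by simp
    ultimately show ?thesis by linarith
  qed
  ultimately have "- (a / N) * u + - (a / N) * v \<le> p * u + q * v"
    using uv by (intro add_mono mult_right_mono)
  then have 1: "- ((u + v) / (4 * real n * N)) \<le> p * u + q * v"
    by (simp add: a_def add_divide_distrib)

  \<comment> \<open>As |x|^2 = u + v, it suffices that \<open>c\<close> bounds both coefficients
    below. The factor 32 = 2^5 comes from the coefficient bounds, 2^(2/n) from R^2 \<le> 2^(8a)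
    N^4.\<close>
  define c where "c = 1 / (2 powr (5 + 2 / real n) * N\<^sup>2)"
  have c: "c \<le> N\<^sup>2 / R\<^sup>2 * (1 / 32)"
  proof -
    have "2 powr (5 + 2 / real n) = 32 * 2 powr (8 * a)" by (simp add: powr_add a_def)
    then show ?thesis using N R by (simp add: c_def field_simps power2_eq_square)
  qed
  have "c * u + c * v \<le> (p\<^sup>2 + T\<^sup>2 / 4) * u + (q\<^sup>2 + T\<^sup>2) * v"
  proof (intro add_mono mult_right_mono uv)
    show "c \<le> p\<^sup>2 + T\<^sup>2 / 4"
      unfolding pT l_def m_def using u_coefficient_lower[OF a \<beta> \<sigma>\<beta> \<tau>]
      by (intro order_trans[OF c] mult_left_mono NR) simp
    show "c \<le> q\<^sup>2 + T\<^sup>2"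
      unfolding qT l_def m_def using v_coefficient_lower[OF a \<beta> \<sigma>\<beta> \<tau>]
      by (intro order_trans[OF c] mult_left_mono NR)
  qed
  then have 2: "(u + v) / (2 powr (5 + 2 / real n) * N\<^sup>2) \<le> (p\<^sup>2 + T\<^sup>2 / 4) * u + (q\<^sup>2 + T\<^sup>2) * v"
    by (simp add: c_def add_divide_distrib)

  define d where "d = (1 + 2 * a)\<^sup>2 / 2 / N\<^sup>2"
  have d: "N\<^sup>2 / R\<^sup>2 * (\<sigma>\<^sup>2 * ((1 + 2 * a)\<^sup>2 / 2)) \<le> d"
  proof -
    \<comment> \<open>The \<sigma>^2 in the upper coefficient bounds is used up here: squaring turns
      N^2 \<sigma>^2 / R^2 into at most 1 / N^2.\<close>
    have "N\<^sup>2 * \<sigma> \<le> R" using N \<sigma> by (simp add: field_simps)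
    then have "(N\<^sup>2 * \<sigma>)\<^sup>2 \<le> R\<^sup>2" using \<sigma> by (intro power_mono) auto
    then have "N\<^sup>2 / R\<^sup>2 * \<sigma>\<^sup>2 \<le> 1 / N\<^sup>2" using N R by (simp add: field_simps power2_eq_square)
    then have "N\<^sup>2 / R\<^sup>2 * \<sigma>\<^sup>2 * ((1 + 2 * a)\<^sup>2 / 2) \<le> 1 / N\<^sup>2 * ((1 + 2 * a)\<^sup>2 / 2)"
      by (rule mult_right_mono) simp
    then show ?thesis by (simp add: d_def)
  qed
  have "(p\<^sup>2 + T\<^sup>2 / 4) * u + (q\<^sup>2 + T\<^sup>2) * v \<le> d * u + d * v"
  proof (intro add_mono mult_right_mono uv)
    show "p\<^sup>2 + T\<^sup>2 / 4 \<le> d"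
      unfolding pT l_def m_def using u_coefficient_upper[OF a \<beta> \<sigma> \<sigma>\<beta> \<tau>]
      by (intro order_trans[OF _ d] mult_left_mono NR)
    show "q\<^sup>2 + T\<^sup>2 \<le> d"
      unfolding qT l_def m_def using v_coefficient_upper[OF a \<beta> \<sigma> \<sigma>\<beta> \<tau>]
      by (intro order_trans[OF _ d] mult_left_mono NR)
  qed
  moreover have "d = (2 * real n + 1)\<^sup>2 / (2 ^ 3 * (real n)\<^sup>2 * N\<^sup>2)"
  proof -
    have "1 + 2 * a = (2 * real n + 1) / (2 * real n)" using n by (simp add: a_def field_simps)
    then show ?thesis by (simp add: d_def power_divide power_mult_distrib)
  qed
  ultimately have 3: "(p\<^sup>2 + T\<^sup>2 / 4) * u + (q\<^sup>2 + T\<^sup>2) * v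
      \<le> (2 * real n + 1)\<^sup>2 * (u + v) / (2 ^ 3 * (real n)\<^sup>2 * N\<^sup>2)"
    by (simp add: add_divide_distrib distrib_left)
  show ?thesis
    unfolding grad xn N_def[symmetric] using 1 2 3 by blast
qed

end
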